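(* Let $\langle\,,\,\rangle$ be a flat metric on a real Lie algebra $\mathfrak g$ and let $\nabla$ denote its Levi-Civita connection. Then $T_\nabla\mathfrak g$ possesses a natural pseudo-Kähler structure, namely $(K,\omega)$ with $$K(x,y)=(y,-x),\qquad \omega((x,y),(x',y'))=\langle y,x'\rangle-\langle y',x\rangle .$$
   Context: Lie algebras are finite-dimensional over $\mathbb R$. A metric on $\mathfrak g$ is a non-degenerate symmetric bilinear form (not necessarily definite). Its Levi-Civita connection is the unique linear map $\nabla:\mathfrak g\to\mathfrak{gl}(\mathfrak g)$, $x\mapsto\nabla_x$, with $\nabla_xy-\nabla_yx=[x,y]$ and $\langle\nabla_xy,z\rangle+\langle y,\nabla_xz\rangle=0$ for all $x,y,z$. The metric is flat if $\nabla_{[x,y]}=[\nabla_x,\nabla_y]$ for all $x,y$. The tangent algebra $T_\nabla\mathfrak g$ is the vector space $\mathfrak g\oplus\mathfrak g$ with bracket $[(x,u),(y,v)]=([x,y],\nabla_xv-\nabla_yu)$. A complex structure on a Lie algebra is an endomorphism $J$ with $J^2=-1$ and $J[x,y]-[Jx,y]-[x,Jy]-J[Jx,Jy]=0$. A symplectic structure is a non-degenerate skew-symmetric bilinear form $\omega$ with $\omega(x,[y,z])+\omega(y,[z,x])+\omega(z,[x,y])=0$. A pseudo-Kähler structure is a pair $(J,\omega)$ of a complex structure and a symplectic structure for which there is a non-degenerate symmetric bilinear form $g$ with $g(Ja,Jb)=g(a,b)$ and $\omega(a,b)=g(Ja,b)$; here $g$ is the metric $\langle(x,y),(x',y')\rangle=\langle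 x,x'\rangle+\langle y,y'\rangle$. *)

theory Defs
  imports "HOL-Analysis.Analysis"
begin

text \<open>A Lie algebra is given by its bracket on a real vector space type. No norm, topology or
  preferred inner product is fixed on the underlying space (which may be zero-dimensional).\<close>

definition finite_dim :: "'a::real_vector itself \<Rightarrow> bool" where
  "finite_dim _ \<longleftrightarrow> (\<exists>B::'a set. finite B \<and> span B = UNIV)"

definition lie_algebra :: "('a::real_vector \<Rightarrow> 'a \<Rightarrow> 'a) \<Rightarrow> bool" where
  "lie_algebra br \<longleftrightarrow>
     finite_dim TYPE('a) \<and> bilinear br \<and> (\<forall>x. br x x = 0) \<and>
     (\<forall>x y z. br x (br y z) + br y (br z x) + br z (br x y) = 0)"

definition nondegenerate :: "('a::real_vector \<Rightarrow> 'a \<Rightarrow> real) \<Rightarrow> bool" where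
  "nondegenerate b \<longleftrightarrow>
     (\<forall>x. (\<forall>y. b x y = 0) \<longrightarrow> x = 0) \<and> (\<forall>y. (\<forall>x. b x y = 0) \<longrightarrow> y = 0)"

definition metric :: "('a::real_vector \<Rightarrow> 'a \<Rightarrow> real) \<Rightarrow> bool" where
  "metric m \<longleftrightarrow> bilinear m \<and> (\<forall>x y. m x y = m y x) \<and> nondegenerate m"

text \<open>A linear map from the Lie algebra to its endomorphisms is represented, uncurried, by a
  bilinear map: \<open>D x y\<close> stands for \<open>\<nabla>\<^sub>x y\<close>.\<close>

definition is_levi_civita ::
    "('a::real_vector \<Rightarrow> 'a \<Rightarrow> 'a) \<Rightarrow> ('a \<Rightarrow> 'a \<Rightarrow> real) \<Rightarrow> ('a \<Rightarrow> 'a \<Rightarrow> 'a) \<Rightarrow> bool" where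
  "is_levi_civita br m D \<longleftrightarrow>
     bilinear D \<and>
     (\<forall>x y. D x y - D y x = br x y) \<and>
     (\<forall>x y z. m (D x y) z + m y (D x z) = 0)"

definition levi_civita ::
    "('a::real_vector \<Rightarrow> 'a \<Rightarrow> 'a) \<Rightarrow> ('a \<Rightarrow> 'a \<Rightarrow> real) \<Rightarrow> 'a \<Rightarrow> 'a \<Rightarrow> 'a" where
  "levi_civita br m = (THE D. is_levi_civita br m D)"

definition flat_metric :: "('a::real_vector \<Rightarrow> 'a \<Rightarrow> 'a) \<Rightarrow> ('a \<Rightarrow> 'a \<Rightarrow> real) \<Rightarrow> bool" where
  "flat_metric br m \<longleftrightarrow>
     metric m \<and>
     (\<forall>x y. levi_civita br m (br x y) =
        (\<lambda>z. levi_civita br m x (levi_civita br m y z) - levi_civita br m y (levi_civita br m x z)))"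

definition tangent_bracket ::
    "('a::real_vector \<Rightarrow> 'a \<Rightarrow> 'a) \<Rightarrow> ('a \<Rightarrow> 'a \<Rightarrow> 'a) \<Rightarrow> 'a \<times> 'a \<Rightarrow> 'a \<times> 'a \<Rightarrow> 'a \<times> 'a" where
  "tangent_bracket br D = (\<lambda>(x, u) (y, v). (br x y, D x v - D y u))"

definition complex_structure :: "('a::real_vector \<Rightarrow> 'a \<Rightarrow> 'a) \<Rightarrow> ('a \<Rightarrow> 'a) \<Rightarrow> bool" where
  "complex_structure br J \<longleftrightarrow>
     linear J \<and> (\<forall>x. J (J x) = - x) \<and>
     (\<forall>x y. J (br x y) - br (J x) y - br x (J y) - J (br (J x) (J y)) = 0)"

definition symplectic_structure ::
    "('a::real_vector \<Rightarrow> 'a \<Rightarrow> 'a) \<Rightarrow> ('a \<Rightarrow> 'a \<Rightarrow> real) \<Rightarrow> bool" where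
  "symplectic_structure br w \<longleftrightarrow>
     bilinear w \<and> (\<forall>x y. w x y = - w y x) \<and> nondegenerate w \<and>
     (\<forall>x y z. w x (br y z) + w y (br z x) + w z (br x y) = 0)"

definition compatible_metric ::
    "('a::real_vector \<Rightarrow> 'a) \<Rightarrow> ('a \<Rightarrow> 'a \<Rightarrow> real) \<Rightarrow> ('a \<Rightarrow> 'a \<Rightarrow> real) \<Rightarrow> bool" where
  "compatible_metric J w g \<longleftrightarrow>
     metric g \<and> (\<forall>a b. g (J a) (J b) = g a b) \<and> (\<forall>a b. w a b = g (J a) b)"

definition pseudo_kaehler ::
    "('a::real_vector \<Rightarrow> 'a \<Rightarrow> 'a) \<Rightarrow> ('a \<Rightarrow> 'a) \<Rightarrow> ('a \<Rightarrow> 'a \<Rightarrow> real) \<Rightarrow> bool" where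
  "pseudo_kaehler br J w \<longleftrightarrow>
     complex_structure br J \<and> symplectic_structure br w \<and> (\<exists>g. compatible_metric J w g)"

end

theory Submission
  imports Defs
begin

text \<open>
  Everything rests on three properties of \<open>\<nabla>\<close>: it is torsion-free, each \<open>\<nabla>\<^sub>x\<close> is skew for the
  metric, and by flatness \<open>\<nabla>\<close> is a representation of the Lie algebra. The bracket of the tangent algebra is that of the semidirect product
  of \<open>\<gg>\<close> with the module \<open>\<gg>\<close> on which it acts through \<open>\<nabla>\<close>, so the Jacobi identity is the Jacobi
  identity of \<open>\<gg>\<close> in the first component and flatness in the second. Integrability of \<open>K\<close>
  unfolds to instances of torsion-freeness. Closedness of \<open>\<omega>\<close> follows by rewriting
  the brackets of \<open>\<gg>\<close> with torsion-freeness, after which the terms cancel in pairs by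
  skewness. Compatibility of \<open>g\<close> with \<open>K\<close> is immediate, and \<open>\<omega>\<close> inherits
  non-degeneracy from \<open>g\<close> because \<open>\<omega>(a, b) = g(Ka, b)\<close> and \<open>K\<close> is invertible.

  Since \<open>\<nabla>\<close> is given by a definite description, torsion-freeness and skewness are available only
  once existence and uniqueness of such a connection are known. Both come from the Koszul formula
  \<open>2 \<langle>\<nabla>\<^sub>x y, z\<rangle> = \<langle>[x,y], z\<rangle> - \<langle>[y,z], x\<rangle> + \<langle>[z,x], y\<rangle>\<close>: these two properties force it, and conversely
  non-degeneracy in finite dimension lets every linear functional of \<open>z\<close> be represented
  by a vector (\<open>nondegenerate_represents_functional\<close>), so that it can serve as a definition.
\<close>

section \<open>Non-degenerate forms in finite dimension\<close>

text \<open>In a basis \<open>B\<close>, the map \<open>x \<mapsto> \<Sum>b\<in>B. m x b \<cdot> b\<close> records the functional \<open>m x\<close> by its values on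
  \<open>B\<close>. Non-degeneracy makes it injective, so as a linear endomorphism of a finite-dimensional
  space it is surjective.\<close>

lemma nondegenerate_represents_functional:
  fixes m :: "'a::real_vector \<Rightarrow> 'a \<Rightarrow> real"
  assumes fin: "finite_dim TYPE('a)" and bil: "bilinear m" and nd: "nondegenerate m"
    and f: "linear f"
  shows "\<exists>u. \<forall>y. m u y = f y"
proof -
  obtain S :: "'a set" where S: "finite S" "span S = UNIV"
    using fin by (auto simp: finite_dim_def)
  obtain B where B: "B \<subseteq> S" "independent B" "S \<subseteq> span B"
    using maximal_independent_subset[of S] by blast
  have finB: "finite B"
    using B(1) S(1) finite_subset by blast
  have spanB: "span B = UNIV"
    using span_minimal[OF B(3) subspace_span] S(2) by auto
  interpret fd: finite_dimensional_vector_space "scaleR :: real \<Rightarrow> 'a \<Rightarrow> 'a" B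
    by unfold_locales
      (use finB spanB B(2) in \<open>simp_all add: dependent_raw_def span_raw_def scaleR_add_right scaleR_add_left\<close>)
  have ext: "h = k" if "linear h" "linear k" "\<And>b. b \<in> B \<Longrightarrow> h b = k b" for h k :: "'a \<Rightarrow> real"
    using linear_eq_on_span[OF that(1,2), of B] that(3) spanB by auto
  have lin_m: "linear (m x)" for x
    using bil by (simp add: bilinear_def)
  define T where "T = (\<lambda>x. \<Sum>b\<in>B. m x b *\<^sub>R b)"
  have lin_T: "linear T"
    unfolding T_def
    by (rule linearI)
      (simp_all add: bilinear_ladd[OF bil] bilinear_lmul[OF bil] scaleR_add_left sum.distrib
        scaleR_sum_right)
  have coeff: "h b = k b" if "(\<Sum>b\<in>B. h b *\<^sub>R b) = (\<Sum>b\<in>B. k b *\<^sub>R b)" "b \<in> B" for h k b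
  proof -
    have "(\<Sum>b\<in>B. (h b - k b) *\<^sub>R b) = 0"
      using that(1) by (simp add: scaleR_diff_left sum_subtractf)
    then have "h b - k b = 0"
      by (rule independentD[OF B(2) finB subset_refl _ that(2)])
    then show ?thesis by simp
  qed
  have "inj T"
    unfolding linear_injective_0[OF lin_T]
  proof (intro allI impI)
    fix x assume "T x = 0"
    then have "m x b = 0" if "b \<in> B" for b
      using coeff[of "m x" "\<lambda>_. 0" b] that by (simp add: T_def)
    then have "m x = (\<lambda>_. 0)"
      by (intro ext lin_m) (auto simp: linear_zero)
    then show "x = 0"
      using nd by (simp add: nondegenerate_def)
  qed
  then have "surj T"
    using fd.linear_inj_imp_surj lin_T by (simp add: linear_def)
  then obtain u where "T u = (\<Sum>b\<in>B. f b *\<^sub>R b)"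
    by (metis surjD)
  then have "m u = f"
    by (intro ext lin_m f) (auto simp: T_def intro: coeff)
  then show ?thesis by auto
qed

lemma nondegenerate_eqI:
  assumes "bilinear m" "nondegenerate m" "\<And>z. m x z = m y z"
  shows "x = y"
proof -
  have "m (x - y) z = 0" for z
    using assms(1,3) by (simp add: bilinear_lsub)
  then have "x - y = 0"
    using assms(2) unfolding nondegenerate_def by blast
  then show ?thesis by simp
qed

section \<open>The Levi-Civita connection\<close>

lemma lie_algebra_antisym:
  assumes "lie_algebra br"
  shows "br y x = - br x y"
proof -
  have bil: "bilinear br" and alt: "\<And>x. br x x = 0"
    using assms by (auto simp: lie_algebra_def)
  have "br (x + y) (x + y) = br x y + br y x"
    unfolding bilinear_ladd[OF bil] bilinear_radd[OF bil] by (simp add: alt)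
  then show ?thesis
    using alt[of "x + y"] by (simp add: eq_neg_iff_add_eq_0 add.commute)
qed

text \<open>Writing each bracket as a difference by torsion-freeness, the right-hand side becomes a sum
  of six terms. By skewness those with \<open>\<nabla>\<^sub>y\<close> and those with \<open>\<nabla>\<^sub>z\<close> cancel, and the two with \<open>\<nabla>\<^sub>x\<close> are
  equal. As the right-hand side itself does not mention \<open>\<nabla>\<close>, this yields uniqueness.\<close>

lemma levi_civita_koszul:
  assumes m: "metric m" and lc: "is_levi_civita br m D"
  shows "2 * m (D x y) z = m (br x y) z - m (br y z) x + m (br z x) y"
proof -
  have bil: "bilinear m" and sym: "\<And>x y. m x y = m y x"
    using m by (auto simp: metric_def)
  have tor: "br x y = D x y - D y x" for x y
    using lc by (simp add: is_levi_civita_def)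
  have skew: "m (D x y) z + m (D x z) y = 0" for x y z
    using lc sym by (metis is_levi_civita_def)
  show ?thesis
    using skew[of x y z] skew[of y x z] skew[of z x y]
    by (simp add: tor bilinear_lsub[OF bil])
qed

text \<open>Each defining property of a Levi-Civita connection is checked after pairing with an
  arbitrary vector, where the Koszul formula turns it into an identity between brackets.\<close>

lemma levi_civita_exists:
  fixes br :: "'a::real_vector \<Rightarrow> 'a \<Rightarrow> 'a"
  assumes L: "lie_algebra br" and m: "metric m"
  shows "\<exists>D. is_levi_civita br m D"
proof -
  have fin: "finite_dim TYPE('a)" and bbr: "bilinear br"
    using L by (auto simp: lie_algebra_def)
  have bil: "bilinear m" and sym: "\<And>x y. m x y = m y x" and nd: "nondegenerate m"
    using m by (auto simp: metric_def)
  note lin = bilinear_ladd[OF bil] bilinear_radd[OF bil] bilinear_lmul[OF bil] bilinear_rmul[OF bil]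
    bilinear_lsub[OF bil] bilinear_lneg[OF bil]
    bilinear_ladd[OF bbr] bilinear_radd[OF bbr] bilinear_lmul[OF bbr] bilinear_rmul[OF bbr]
  define k where "k x y z = (m (br x y) z - m (br y z) x + m (br z x) y) / 2" for x y z
  have "linear (k x y)" for x y
    unfolding k_def by (rule linearI) (simp_all add: lin field_simps)
  then have "\<forall>x y. \<exists>u. \<forall>z. m u z = k x y z"
    using nondegenerate_represents_functional[OF fin bil nd] by blast
  then obtain D where D: "\<And>x y z. m (D x y) z = k x y z"
    by metis
  have antisym: "br y x = - br x y" for x y
    by (rule lie_algebra_antisym[OF L])
  have "bilinear D"
    unfolding bilinear_def
    by (intro conjI allI linearI nondegenerate_eqI[OF bil nd])
      (simp_all add: lin D k_def field_simps)
  moreover have "D x y - D y x = br x y" for x y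
  proof (rule nondegenerate_eqI[OF bil nd])
    fix z
    show "m (D x y - D y x) z = m (br x y) z"
      by (simp add: lin D k_def antisym[of x y] antisym[of x z] antisym[of y z] field_simps)
  qed
  moreover have "m (D x y) z + m y (D x z) = 0" for x y z
    by (simp add: sym[of y] lin D k_def antisym[of x y] antisym[of x z] antisym[of y z]
        field_simps)
  ultimately show ?thesis
    unfolding is_levi_civita_def by blast
qed

lemma is_levi_civita_levi_civita:
  assumes "lie_algebra br" and m: "metric m"
  shows "is_levi_civita br m (levi_civita br m)"
  unfolding levi_civita_def
proof (rule theI'[where P = "is_levi_civita br m"])
  have "D = E" if "is_levi_civita br m D" "is_levi_civita br m E" for D E
  proof (intro ext nondegenerate_eqI[of m])
    show "m (D x y) z = m (E x y) z" for x y z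
      using levi_civita_koszul[OF m that(1), of x y z] levi_civita_koszul[OF m that(2), of x y z]
      by simp
  qed (use m in \<open>simp_all add: metric_def\<close>)
  then show "\<exists>!D. is_levi_civita br m D"
    using levi_civita_exists[OF assms] by blast
qed

section \<open>The tangent algebra\<close>

lemma finite_dim_prod:
  assumes "finite_dim TYPE('a::real_vector)" "finite_dim TYPE('b::real_vector)"
  shows "finite_dim TYPE('a \<times> 'b)"
proof -
  obtain A :: "'a set" and B :: "'b set"
    where AB: "finite A" "span A = UNIV" "finite B" "span B = UNIV"
    using assms by (auto simp: finite_dim_def)
  let ?i = "\<lambda>x::'a. (x, 0::'b)" and ?j = "\<lambda>y::'b. (0::'a, y)"
  let ?C = "?i ` A \<union> ?j ` B"
  have "linear ?i" "linear ?j"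
    by (auto intro!: linearI)
  then have i: "range ?i \<subseteq> span ?C" and j: "range ?j \<subseteq> span ?C"
    using linear_span_image[of ?i A] linear_span_image[of ?j B] AB
      span_mono[of "?i ` A" ?C] span_mono[of "?j ` B" ?C] by auto
  have "p \<in> span ?C" for p
    using span_add[of "?i (fst p)" ?C "?j (snd p)"] i j by auto
  then show ?thesis
    unfolding finite_dim_def using AB by (intro exI[of _ ?C]) auto
qed

text \<open>A semidirect product: the second summand is an abelian ideal on which the first acts through
  \<open>D\<close>. The second component of the Jacobi identity is exactly the representation
  property \<open>flat\<close>.\<close>

lemma lie_algebra_tangent_bracket:
  assumes L: "lie_algebra br" and bD: "bilinear D"
    and flat: "\<And>x y z. D (br x y) z = D x (D y z) - D y (D x z)"
  shows "lie_algebra (tangent_bracket br D)"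
proof -
  have bbr: "bilinear br" and alt: "\<And>x. br x x = 0"
    and jac: "\<And>x y z. br x (br y z) + br y (br z x) + br z (br x y) = 0"
    using L by (auto simp: lie_algebra_def)
  note lin = bilinear_ladd[OF bD] bilinear_radd[OF bD] bilinear_lmul[OF bD] bilinear_rmul[OF bD]
    bilinear_rsub[OF bD]
    bilinear_ladd[OF bbr] bilinear_radd[OF bbr] bilinear_lmul[OF bbr] bilinear_rmul[OF bbr]
  have "bilinear (tangent_bracket br D)"
    unfolding bilinear_def
    by (intro conjI allI linearI)
      (auto simp: tangent_bracket_def lin algebra_simps split: prod.splits)
  then show ?thesis
    using L finite_dim_prod jac
    by (auto simp: lie_algebra_def tangent_bracket_def lin flat zero_prod_def)
qed

text \<open>The first component of the integrability condition at \<open>(x, u)\<close>, \<open>(y, v)\<close> consists of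
  torsion-freeness for \<open>(x, v)\<close> and \<open>(u, y)\<close>, the second of torsion-freeness for \<open>(x, y)\<close>
  and \<open>(u, v)\<close>.\<close>

lemma complex_structure_tangent:
  assumes bD: "bilinear D" and tor: "\<And>x y. D x y - D y x = br x y"
  shows "complex_structure (tangent_bracket br D) (\<lambda>(x, y). (y, - x))"
proof -
  have "linear (\<lambda>(x, y). (y, - x))"
    by (rule linearI) auto
  then show ?thesis
    by (auto simp: complex_structure_def tangent_bracket_def tor[symmetric]
        bilinear_rneg[OF bD] zero_prod_def)
qed

section \<open>The metric and the symplectic form\<close>

lemma compatible_metric_tangent:
  assumes m: "metric m"
  shows "compatible_metric (\<lambda>(x, y). (y, - x)) (\<lambda>(x, y) (x', y'). m y x' - m y' x)
    (\<lambda>(x, y) (x', y'). m x x' + m y y')"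
    (is "compatible_metric ?K ?w ?g")
proof -
  have bil: "bilinear m" and sym: "\<And>x y. m x y = m y x" and nd: "nondegenerate m"
    using m by (auto simp: metric_def)
  note lin = bilinear_ladd[OF bil] bilinear_radd[OF bil] bilinear_lmul[OF bil] bilinear_rmul[OF bil]
    bilinear_lneg[OF bil] bilinear_rneg[OF bil]
  have "bilinear ?g"
    unfolding bilinear_def
    by (intro conjI allI linearI) (auto simp: lin algebra_simps)
  moreover have g_sym: "?g a b = ?g b a" for a b
    using sym by (auto split: prod.splits)
  moreover have "nondegenerate ?g"
  proof -
    have left: "a = 0" if "\<forall>b. ?g a b = 0" for a
    proof (cases a)
      case (Pair x y)
      have "m x z = 0" "m y z = 0" for z
        using that[rule_format, of "(z, 0)"] that[rule_format, of "(0, z)"]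
        by (simp_all add: Pair bilinear_rzero[OF bil])
      then show ?thesis
        using nd by (simp add: Pair nondegenerate_def zero_prod_def)
    qed
    then show ?thesis
      using g_sym unfolding nondegenerate_def by metis
  qed
  ultimately have "metric ?g"
    by (simp add: metric_def)
  moreover have "?w a b = ?g (?K a) b" for a b
    using sym by (auto simp: lin split: prod.splits)
  moreover have "?g (?K a) (?K b) = ?g a b" for a b
    by (auto simp: lin split: prod.splits)
  ultimately show ?thesis
    unfolding compatible_metric_def by blast
qed

text \<open>Skewness combines invariance with \<open>J\<^sup>2 = -1\<close>: \<open>g(Ja, b) = g(J(Ja), Jb) = - g(a, Jb)\<close>. It also
  reduces non-degeneracy on the right to that on the left, where \<open>J\<close> is injective.\<close>

lemma compatible_metric_fundamental_form:
  assumes J: "linear J" "\<And>x. J (J x) = - x" and c: "compatible_metric J w g"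
  shows "bilinear w" "w a b = - w b a" "nondegenerate w"
proof -
  have g: "bilinear g" "\<And>a b. g a b = g b a" "nondegenerate g"
    and inv: "\<And>a b. g (J a) (J b) = g a b" and w: "\<And>a b. w a b = g (J a) b"
    using c by (auto simp: compatible_metric_def metric_def)
  show "bilinear w"
    unfolding bilinear_def
    by (intro conjI allI linearI)
      (simp_all add: w linear_add[OF J(1)] linear_scale[OF J(1)] bilinear_ladd[OF g(1)]
        bilinear_radd[OF g(1)] bilinear_lmul[OF g(1)] bilinear_rmul[OF g(1)])
  have skew: "w a b = - w b a" for a b
    using inv[of "J a" b] g(2)[of a "J b"] by (simp add: w J(2) bilinear_lneg[OF g(1)])
  then show "w a b = - w b a" .
  have left: "a = 0" if "\<forall>b. w a b = 0" for a
  proof -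
    have "J a = 0"
      using that g(3) by (simp add: w nondegenerate_def)
    then show ?thesis
      using J(2)[of a] linear_0[OF J(1)] by simp
  qed
  moreover have "b = 0" if "\<forall>a. w a b = 0" for b
    using left that skew by (metis neg_equal_0_iff_equal)
  ultimately show "nondegenerate w"
    unfolding nondegenerate_def by blast
qed

text \<open>For \<open>a = (x, u)\<close>, \<open>b = (y, v)\<close>, \<open>c = (z, w)\<close>, the terms of the cyclic sum that contain \<open>u\<close> are
  \<open>\<langle>u, [y,z]\<rangle>\<close>, \<open>- \<langle>\<nabla>\<^sub>z u, y\<rangle>\<close> and \<open>\<langle>\<nabla>\<^sub>y u, z\<rangle>\<close>. By skewness they add up to
  \<open>\<langle>u, [y,z] - \<nabla>\<^sub>y z + \<nabla>\<^sub>z y\<rangle>\<close>, which vanishes as \<open>\<nabla>\<close> is torsion-free. The terms containing \<open>v\<close>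
  or \<open>w\<close> behave alike.\<close>

lemma tangent_form_closed:
  fixes m :: "'a::real_vector \<Rightarrow> 'a \<Rightarrow> real"
  assumes m: "metric m" and lc: "is_levi_civita br m D"
    and w: "\<omega> = (\<lambda>(x, y) (x', y'). m y x' - m y' x)"
  shows "\<omega> a (tangent_bracket br D b c) + \<omega> b (tangent_bracket br D c a)
    + \<omega> c (tangent_bracket br D a b) = 0"
proof -
  have bil: "bilinear m"
    using m by (simp add: metric_def)
  have tor: "br x y = D x y - D y x" and skew: "m (D x y) z = - m y (D x z)" for x y z
    using lc by (simp_all add: is_levi_civita_def eq_neg_iff_add_eq_0)
  show ?thesis
    by (cases a; cases b; cases c)
      (simp add: w tangent_bracket_def tor bilinear_lsub[OF bil] bilinear_rsub[OF bil] skew)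
qed

theorem corollary4p7:
  fixes br :: "'a::real_vector \<Rightarrow> 'a \<Rightarrow> 'a"
    and m :: "'a \<Rightarrow> 'a \<Rightarrow> real"
    and D :: "'a \<Rightarrow> 'a \<Rightarrow> 'a"
    and K :: "'a \<times> 'a \<Rightarrow> 'a \<times> 'a"
    and \<omega> g :: "'a \<times> 'a \<Rightarrow> 'a \<times> 'a \<Rightarrow> real"
  assumes "lie_algebra br"
    and "flat_metric br m"
    and "D = levi_civita br m"
    and "K = (\<lambda>(x, y). (y, - x))"
    and "\<omega> = (\<lambda>(x, y) (x', y'). m y x' - m y' x)"
    and "g = (\<lambda>(x, y) (x', y'). m x x' + m y y')"
  shows "lie_algebra (tangent_bracket br D) \<and>
         pseudo_kaehler (tangent_bracket br D) K \<omega> \<and>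
         compatible_metric K \<omega> g"
proof -
  have m: "metric m" and flat: "\<And>x y z. D (br x y) z = D x (D y z) - D y (D x z)"
    using assms(2,3) by (simp_all add: flat_metric_def)
  have lc: "is_levi_civita br m D"
    using is_levi_civita_levi_civita[OF assms(1) m] assms(3) by simp
  then have bD: "bilinear D" and tor: "\<And>x y. D x y - D y x = br x y"
    by (simp_all add: is_levi_civita_def)
  have lie: "lie_algebra (tangent_bracket br D)"
    using assms(1) bD flat by (rule lie_algebra_tangent_bracket)
  have compat: "compatible_metric K \<omega> g"
    unfolding assms(4-6) using m by (rule compatible_metric_tangent)
  have cs: "complex_structure (tangent_bracket br D) K"
    unfolding assms(4) using bD tor by (rule complex_structure_tangent)
  then have K: "linear K" "\<And>a. K (K a) = - a"
    unfolding complex_structure_def by blast+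
  have "symplectic_structure (tangent_bracket br D) \<omega>"
    unfolding symplectic_structure_def
    using compatible_metric_fundamental_form[OF K compat] tangent_form_closed[OF m lc assms(5)]
    by blast
  with lie compat cs show ?thesis
    unfolding pseudo_kaehler_def by blast
qed

end
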